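(* Let $C=(a_1,a_2,a_3,a_4,a_5,a_6)$ be a tetrahedral curve where not all $a_i$ are $0$, and assume that $a_6=\max\{a_1,\dots,a_6\}$. Then $C$ is S-minimal if and only if \[ a_1>\max\{a_3+a_5,\;a_2+a_4\}\quad\text{and}\quad a_6>\max\{a_4+a_5,\;a_2+a_3\}. \]
   Context: Let $k$ be a field and $R=k[a,b,c,d]$. For integers $a_1,\dots,a_6\ge0$, the tetrahedral curve $(a_1,\dots,a_6)$ is the subscheme of $\mathbb P^3$ with saturated ideal $(a,b)^{a_1}\cap(a,c)^{a_2}\cap(a,d)^{a_3}\cap(b,c)^{a_4}\cap(b,d)^{a_5}\cap(c,d)^{a_6}$. Reductions. For a tetrahedral curve with not all $a_i$ zero consider the systems (A): $a_1+a_2\ge a_4$, $a_1+a_3\ge a_5$, $a_2+a_3\ge a_6$; (B): $a_1+a_4\ge a_2$, $a_1+a_5\ge a_3$, $a_4+a_5\ge a_6$; (C): $a_2+a_4\ge a_1$, $a_2+a_6\ge a_3$, $a_4+a_6\ge a_5$; (D): $a_3+a_5\ge a_1$, $a_3+a_6\ge a_2$, $a_5+a_6\ge a_4$. If (A) (resp. (B), (C), (D)) holds, the corresponding reduction replaces $a_i$ by $\max\{0,a_i-1\}$ for $i\in\{1,2,3\}$ (resp. $\{1,4,5\}$, $\{2,4,6\}$, $\{3,5,6\}$) and leaves the other weights unchanged. The curve is S-minimal if no such reduction is possible, i.e. none of the systems (A), (B), (C), (D) holds. *)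

theory Defs
  imports Complex_Main "HOL-Library.Poly_Mapping"
begin

datatype coord = Coord_a | Coord_b | Coord_c | Coord_d

text \<open>
  The polynomial ring \<open>R = k[a,b,c,d]\<close>: finitely supported maps from exponent vectors to
  coefficients, with the convolution product of Poly_Mapping.
\<close>
type_synonym 'k coord_ring = "(coord \<Rightarrow>\<^sub>0 nat) \<Rightarrow>\<^sub>0 'k"

definition var :: "coord \<Rightarrow> 'k::field coord_ring" where
  "var v = Poly_Mapping.single (Poly_Mapping.single v 1) 1"

text \<open>The ideal generated by a set is its span in the ring viewed as a module over itself.\<close>
definition ideal_gen :: "'a::comm_ring_1 set \<Rightarrow> 'a set" where
  "ideal_gen S = module.span (*) S"

lemma module_times: "module ((*) :: 'a::comm_ring_1 \<Rightarrow> 'a \<Rightarrow> 'a)"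
  by unfold_locales (simp_all add: algebra_simps)

definition ideal_mult :: "'a::comm_ring_1 set \<Rightarrow> 'a set \<Rightarrow> 'a set" where
  "ideal_mult I J = ideal_gen {x * y | x y. x \<in> I \<and> y \<in> J}"

primrec ideal_power :: "'a::comm_ring_1 set \<Rightarrow> nat \<Rightarrow> 'a set" where
  "ideal_power I 0 = UNIV"
| "ideal_power I (Suc n) = ideal_mult I (ideal_power I n)"

text \<open>A subscheme of projective 3-space is represented by its saturated ideal in \<open>R\<close>.\<close>
definition tetrahedral_curve ::
    "nat \<Rightarrow> nat \<Rightarrow> nat \<Rightarrow> nat \<Rightarrow> nat \<Rightarrow> nat \<Rightarrow> 'k::field coord_ring set" where
  "tetrahedral_curve a1 a2 a3 a4 a5 a6 =
     ideal_power (ideal_gen {var Coord_a, var Coord_b}) a1 \<inter>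
     ideal_power (ideal_gen {var Coord_a, var Coord_c}) a2 \<inter>
     ideal_power (ideal_gen {var Coord_a, var Coord_d}) a3 \<inter>
     ideal_power (ideal_gen {var Coord_b, var Coord_c}) a4 \<inter>
     ideal_power (ideal_gen {var Coord_b, var Coord_d}) a5 \<inter>
     ideal_power (ideal_gen {var Coord_c, var Coord_d}) a6"

text \<open>
  \<open>reduces_to C C'\<close>: one of the reductions is possible for \<open>C\<close> and produces \<open>C'\<close>. Subtraction
  on \<open>nat\<close> truncates, so \<open>a - 1\<close> is \<open>max {0, a - 1}\<close>. The weights are determined by the ideal:
  \<open>a1\<close> is the least \<open>n\<close> such that \<open>a^n * (c * d)^N\<close> lies in the ideal for some \<open>N\<close>, and
  symmetrically for the others. So reducing the ideal is the same as reducing the weights.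
\<close>
inductive reduces_to :: "'k::field coord_ring set \<Rightarrow> 'k coord_ring set \<Rightarrow> bool" where
  A: "\<not> (a1 = 0 \<and> a2 = 0 \<and> a3 = 0 \<and> a4 = 0 \<and> a5 = 0 \<and> a6 = 0) \<Longrightarrow>
      a1 + a2 \<ge> a4 \<Longrightarrow> a1 + a3 \<ge> a5 \<Longrightarrow> a2 + a3 \<ge> a6 \<Longrightarrow>
      reduces_to (tetrahedral_curve a1 a2 a3 a4 a5 a6)
        (tetrahedral_curve (a1 - 1) (a2 - 1) (a3 - 1) a4 a5 a6)"
| B: "\<not> (a1 = 0 \<and> a2 = 0 \<and> a3 = 0 \<and> a4 = 0 \<and> a5 = 0 \<and> a6 = 0) \<Longrightarrow>
      a1 + a4 \<ge> a2 \<Longrightarrow> a1 + a5 \<ge> a3 \<Longrightarrow> a4 + a5 \<ge> a6 \<Longrightarrow>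
      reduces_to (tetrahedral_curve a1 a2 a3 a4 a5 a6)
        (tetrahedral_curve (a1 - 1) a2 a3 (a4 - 1) (a5 - 1) a6)"
| C: "\<not> (a1 = 0 \<and> a2 = 0 \<and> a3 = 0 \<and> a4 = 0 \<and> a5 = 0 \<and> a6 = 0) \<Longrightarrow>
      a2 + a4 \<ge> a1 \<Longrightarrow> a2 + a6 \<ge> a3 \<Longrightarrow> a4 + a6 \<ge> a5 \<Longrightarrow>
      reduces_to (tetrahedral_curve a1 a2 a3 a4 a5 a6)
        (tetrahedral_curve a1 (a2 - 1) a3 (a4 - 1) a5 (a6 - 1))"
| D: "\<not> (a1 = 0 \<and> a2 = 0 \<and> a3 = 0 \<and> a4 = 0 \<and> a5 = 0 \<and> a6 = 0) \<Longrightarrow>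
      a3 + a5 \<ge> a1 \<Longrightarrow> a3 + a6 \<ge> a2 \<Longrightarrow> a5 + a6 \<ge> a4 \<Longrightarrow>
      reduces_to (tetrahedral_curve a1 a2 a3 a4 a5 a6)
        (tetrahedral_curve a1 a2 (a3 - 1) a4 (a5 - 1) (a6 - 1))"

definition S_minimal :: "'k::field coord_ring set \<Rightarrow> bool" where
  "S_minimal C \<longleftrightarrow>
     (\<exists>a1 a2 a3 a4 a5 a6. \<not> (a1 = 0 \<and> a2 = 0 \<and> a3 = 0 \<and> a4 = 0 \<and> a5 = 0 \<and> a6 = 0) \<and>
        C = tetrahedral_curve a1 a2 a3 a4 a5 a6) \<and>
     (\<nexists>C'. reduces_to C C')"

end

theory Submission
  imports Defs
begin

text \<open>
  The ideal of a tetrahedral curve is a monomial ideal, and \<open>a\<^sup>i b\<^sup>j c\<^sup>k d\<^sup>l\<close> lies in \<open>(a,b)\<^sup>n\<close> if and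
  only if \<open>n \<le> i + j\<close>. For large \<open>N\<close> the monomial \<open>a\<^sup>n c\<^sup>N d\<^sup>N\<close> therefore lies in the ideal of the
  curve if and only if \<open>n \<ge> a1\<close>, and symmetrically for the other weights, so the ideal determines
  the weights. The equivalence is then linear arithmetic in the six weights: since \<open>a6\<close> is maximal,
  failure of (C) and (D) means \<open>a1 > a2 + a4\<close> and \<open>a1 > a3 + a5\<close>, and these inequalities make the
  first two conditions of (A) and of (B) hold automatically.
\<close>

text \<open>Think of \<open>w\<close> as a degree on exponent vectors. Leaving it abstract lets one
  argument serve all six pairs of variables.\<close>

definition order_ideal :: "('i \<Rightarrow> nat) \<Rightarrow> nat \<Rightarrow> ('i \<Rightarrow>\<^sub>0 'k::zero) set" where
  "order_ideal w n = {p. \<forall>m \<in> Poly_Mapping.keys p. n \<le> w m}"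

lemma mult_mem_order_ideal:
  fixes p q :: "'i::monoid_add \<Rightarrow>\<^sub>0 'k::semiring_0"
  assumes "\<And>m m'. w (m + m') = w m + w m'"
    and "p \<in> order_ideal w i" "q \<in> order_ideal w j"
  shows "p * q \<in> order_ideal w (i + j)"
  using assms keys_mult[of p q] unfolding order_ideal_def by (fastforce intro: add_mono)

text \<open>For additive \<open>w\<close> the set \<open>order_ideal w n\<close> is itself an ideal,
  and the span is the least ideal containing \<open>S\<close>.\<close>

lemma ideal_gen_subset_order_ideal:
  fixes S :: "('i::comm_monoid_add \<Rightarrow>\<^sub>0 'k::comm_ring_1) set"
  assumes add: "\<And>m m'. w (m + m') = w m + w m'"
    and S: "S \<subseteq> order_ideal w n"
  shows "ideal_gen S \<subseteq> order_ideal w n"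
proof -
  have "p + q \<in> order_ideal w n" if "p \<in> order_ideal w n" "q \<in> order_ideal w n"
    for p q :: "'i \<Rightarrow>\<^sub>0 'k"
    using that subsetD[OF Poly_Mapping.keys_add[of p q]] by (auto simp: order_ideal_def)
  \<comment> \<open>Weights are natural numbers, so an arbitrary \<open>r\<close> has order at least
    0 and multiplication by it cannot lower the order.\<close>
  moreover have "r * p \<in> order_ideal w n" if "p \<in> order_ideal w n" for r p :: "'i \<Rightarrow>\<^sub>0 'k"
    using mult_mem_order_ideal[OF add _ that, of r 0] by (simp add: order_ideal_def)
  moreover have "0 \<in> (order_ideal w n :: ('i \<Rightarrow>\<^sub>0 'k) set)"
    by (simp add: order_ideal_def)
  ultimately have "module.subspace (*) (order_ideal w n :: ('i \<Rightarrow>\<^sub>0 'k) set)"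
    unfolding module.subspace_def[OF module_times] by blast
  then show ?thesis
    unfolding ideal_gen_def using S by (intro module.span_minimal[OF module_times])
qed

lemma ideal_power_subset_order_ideal:
  fixes I :: "('i::comm_monoid_add \<Rightarrow>\<^sub>0 'k::comm_ring_1) set"
  assumes add: "\<And>m m'. w (m + m') = w m + w m'"
    and I: "I \<subseteq> order_ideal w 1"
  shows "ideal_power I n \<subseteq> order_ideal w n"
proof (induction n)
  case 0
  then show ?case by (simp add: order_ideal_def)
next
  case (Suc n)
  have "x * y \<in> order_ideal w (Suc n)" if "x \<in> I" "y \<in> ideal_power I n" for x y
    using mult_mem_order_ideal[OF add subsetD[OF I that(1)] subsetD[OF Suc.IH that(2)]] by simp
  then show ?case
    unfolding ideal_power.simps ideal_mult_def
    by (intro ideal_gen_subset_order_ideal add) blast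
qed

lemma ideal_gen_superset: "S \<subseteq> ideal_gen S"
  unfolding ideal_gen_def by (rule module.span_superset[OF module_times])

lemma monomial_eq_var_mult:
  assumes "0 < Poly_Mapping.lookup m v"
  shows "(Poly_Mapping.single m 1 :: 'k::field coord_ring) =
    var v * Poly_Mapping.single (m - Poly_Mapping.single v 1) 1"
proof -
  have "m = Poly_Mapping.single v 1 + (m - Poly_Mapping.single v 1)"
    using assms
    by (intro poly_mapping_eqI) (auto simp: lookup_add lookup_minus lookup_single when_def)
  then show ?thesis
    by (simp add: var_def Poly_Mapping.mult_single)
qed

text \<open>Induction on \<open>n\<close> splits off one factor \<open>var u\<close> or
  \<open>var v\<close> with positive exponent; \<open>m\<close> varies because the cofactor is a
  smaller monomial.\<close>

lemma monomial_mem_ideal_power: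
  assumes "u \<noteq> v" "n \<le> Poly_Mapping.lookup m u + Poly_Mapping.lookup m v"
  shows "(Poly_Mapping.single m 1 :: 'k::field coord_ring) \<in> ideal_power (ideal_gen {var u, var v}) n"
  using assms(2)
proof (induction n arbitrary: m)
  case 0
  then show ?case by simp
next
  case (Suc n)
  obtain x where x: "x = u \<or> x = v" and pos: "0 < Poly_Mapping.lookup m x"
    using Suc.prems by (metis add_is_0 not_gr_zero not_less_eq_eq zero_le)
  have "(Poly_Mapping.single (m - Poly_Mapping.single x 1) 1 :: 'k coord_ring)
      \<in> ideal_power (ideal_gen {var u, var v}) n"
    \<comment> \<open>As \<open>u\<close> and \<open>v\<close> differ, dividing by \<open>x\<close>
      lowers the sum of the two exponents by exactly one; for \<open>u = v\<close> it would drop by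
      two.\<close>
    using x pos Suc.prems \<open>u \<noteq> v\<close>
    by (intro Suc.IH) (auto simp: lookup_minus lookup_single when_def)
  moreover have "(var x :: 'k coord_ring) \<in> ideal_gen {var u, var v}"
    using x ideal_gen_superset by blast
  ultimately show ?case
    unfolding monomial_eq_var_mult[OF pos] ideal_power.simps ideal_mult_def
    by (intro subsetD[OF ideal_gen_superset]) blast
qed

lemma monomial_mem_ideal_power_iff:
  assumes "u \<noteq> v"
  shows "(Poly_Mapping.single m 1 :: 'k::field coord_ring) \<in> ideal_power (ideal_gen {var u, var v}) n
    \<longleftrightarrow> n \<le> Poly_Mapping.lookup m u + Poly_Mapping.lookup m v"
proof
  \<comment> \<open>The joint degree in \<open>u\<close> and \<open>v\<close> is additive and equals
    1 on both generators, so it bounds membership in the power from the other side.\<close>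
  define w where "w m = Poly_Mapping.lookup m u + Poly_Mapping.lookup m v" for m :: "coord \<Rightarrow>\<^sub>0 nat"
  have add: "w (m + m') = w m + w m'" for m m'
    by (simp add: w_def lookup_add)
  have "{var u, var v} \<subseteq> (order_ideal w 1 :: 'k coord_ring set)"
    by (auto simp: order_ideal_def var_def w_def)
  then have "(ideal_power (ideal_gen {var u, var v}) n :: 'k coord_ring set) \<subseteq> order_ideal w n"
    by (intro ideal_power_subset_order_ideal ideal_gen_subset_order_ideal add)
  moreover assume "(Poly_Mapping.single m 1 :: 'k coord_ring) \<in> ideal_power (ideal_gen {var u, var v}) n"
  ultimately show "n \<le> Poly_Mapping.lookup m u + Poly_Mapping.lookup m v"
    by (auto simp: order_ideal_def w_def)
qed (rule monomial_mem_ideal_power[OF assms])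

definition exponents :: "nat \<Rightarrow> nat \<Rightarrow> nat \<Rightarrow> nat \<Rightarrow> (coord \<Rightarrow>\<^sub>0 nat)" where
  "exponents i j k l = Poly_Mapping.single Coord_a i + Poly_Mapping.single Coord_b j +
    Poly_Mapping.single Coord_c k + Poly_Mapping.single Coord_d l"

lemma monomial_mem_tetrahedral_curve_iff:
  "(Poly_Mapping.single (exponents i j k l) 1 :: 'k::field coord_ring)
      \<in> tetrahedral_curve a1 a2 a3 a4 a5 a6 \<longleftrightarrow>
    a1 \<le> i + j \<and> a2 \<le> i + k \<and> a3 \<le> i + l \<and> a4 \<le> j + k \<and> a5 \<le> j + l \<and> a6 \<le> k + l"
  by (simp add: tetrahedral_curve_def monomial_mem_ideal_power_iff exponents_def lookup_add
      lookup_single when_def)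

lemma tetrahedral_curve_weights_le:
  assumes "(tetrahedral_curve a1 a2 a3 a4 a5 a6 :: 'k::field coord_ring set) \<subseteq>
    tetrahedral_curve b1 b2 b3 b4 b5 b6"
  shows "b1 \<le> a1 \<and> b2 \<le> a2 \<and> b3 \<le> a3 \<and> b4 \<le> a4 \<and> b5 \<le> a5 \<and> b6 \<le> a6"
proof -
  define N where "N = a1 + a2 + a3 + a4 + a5 + a6"
  have le: "b1 \<le> i + j \<and> b2 \<le> i + k \<and> b3 \<le> i + l \<and> b4 \<le> j + k \<and> b5 \<le> j + l \<and> b6 \<le> k + l"
    if "a1 \<le> i + j" "a2 \<le> i + k" "a3 \<le> i + l" "a4 \<le> j + k" "a5 \<le> j + l" "a6 \<le> k + l" for i j k l
    using subsetD[OF assms, of "Poly_Mapping.single (exponents i j k l) 1"] that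
    by (simp add: monomial_mem_tetrahedral_curve_iff)
  show ?thesis
    \<comment> \<open>Each test monomial meets one \<open>a\<close>-weight with equality. The other
      five exponent sums contain \<open>N\<close>, which is at least every
      \<open>a\<close>-weight.\<close>
    using le[of a1 0 N N] le[of a2 N 0 N] le[of a3 N N 0] le[of N a4 0 N] le[of N a5 N 0]
      le[of N N a6 0]
    by (simp add: N_def)
qed

lemma tetrahedral_curve_eq_iff:
  "(tetrahedral_curve a1 a2 a3 a4 a5 a6 :: 'k::field coord_ring set) =
      tetrahedral_curve b1 b2 b3 b4 b5 b6 \<longleftrightarrow>
    a1 = b1 \<and> a2 = b2 \<and> a3 = b3 \<and> a4 = b4 \<and> a5 = b5 \<and> a6 = b6"
proof
  assume "(tetrahedral_curve a1 a2 a3 a4 a5 a6 :: 'k coord_ring set) =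
    tetrahedral_curve b1 b2 b3 b4 b5 b6"
  then show "a1 = b1 \<and> a2 = b2 \<and> a3 = b3 \<and> a4 = b4 \<and> a5 = b5 \<and> a6 = b6"
    using tetrahedral_curve_weights_le[of a1 a2 a3 a4 a5 a6 b1 b2 b3 b4 b5 b6, where 'k = 'k]
      tetrahedral_curve_weights_le[of b1 b2 b3 b4 b5 b6 a1 a2 a3 a4 a5 a6, where 'k = 'k]
    by (intro conjI order.antisym) simp_all
qed simp

lemma S_minimal_tetrahedral_curve_iff:
  assumes nz: "\<not> (a1 = 0 \<and> a2 = 0 \<and> a3 = 0 \<and> a4 = 0 \<and> a5 = 0 \<and> a6 = 0)"
  shows "S_minimal (tetrahedral_curve a1 a2 a3 a4 a5 a6 :: 'k::field coord_ring set) \<longleftrightarrow>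
    \<not> (a1 + a2 \<ge> a4 \<and> a1 + a3 \<ge> a5 \<and> a2 + a3 \<ge> a6) \<and>
    \<not> (a1 + a4 \<ge> a2 \<and> a1 + a5 \<ge> a3 \<and> a4 + a5 \<ge> a6) \<and>
    \<not> (a2 + a4 \<ge> a1 \<and> a2 + a6 \<ge> a3 \<and> a4 + a6 \<ge> a5) \<and>
    \<not> (a3 + a5 \<ge> a1 \<and> a3 + a6 \<ge> a2 \<and> a5 + a6 \<ge> a4)"
    (is "S_minimal ?C \<longleftrightarrow> ?irreducible")
proof -
  have "\<not> reduces_to ?C C'" if ?irreducible for C'
  proof
    assume "reduces_to ?C C'"
    then show False
      \<comment> \<open>Inversion yields unknown weights with the same ideal; as the ideal
        determines them, they are the given ones and the system that holds contradicts the
        assumption.\<close>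
      using that by cases (auto simp only: tetrahedral_curve_eq_iff)
  qed
  moreover have ?irreducible if "\<And>C'. \<not> reduces_to ?C C'"
    by (intro conjI notI; elim conjE)
      (rule reduces_to.intros[OF nz, THEN that[THEN notE]]; assumption)+
  ultimately have "(\<nexists>C'. reduces_to ?C C') \<longleftrightarrow> ?irreducible"
    by metis
  moreover have "\<exists>b1 b2 b3 b4 b5 b6.
      \<not> (b1 = 0 \<and> b2 = 0 \<and> b3 = 0 \<and> b4 = 0 \<and> b5 = 0 \<and> b6 = 0) \<and>
      ?C = tetrahedral_curve b1 b2 b3 b4 b5 b6"
    by (intro exI conjI, rule nz, rule refl)
  ultimately show ?thesis
    unfolding S_minimal_def by (simp only: simp_thms)
qed

theorem corollary3p5:
  fixes C :: "'k::field coord_ring set"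
    and a1 a2 a3 a4 a5 a6 :: nat
  assumes "C = tetrahedral_curve a1 a2 a3 a4 a5 a6"
    and "\<not> (a1 = 0 \<and> a2 = 0 \<and> a3 = 0 \<and> a4 = 0 \<and> a5 = 0 \<and> a6 = 0)"
    and "a6 = Max {a1, a2, a3, a4, a5, a6}"
  shows "S_minimal C \<longleftrightarrow>
    a1 > max (a3 + a5) (a2 + a4) \<and> a6 > max (a4 + a5) (a2 + a3)"
proof -
  have "x \<le> a6" if "x \<in> {a1, a2, a3, a4, a5, a6}" for x
    using Max_ge[OF _ that] unfolding assms(3)[symmetric] by simp
  then have "a2 \<le> a6" "a3 \<le> a6" "a4 \<le> a6" "a5 \<le> a6"
    by simp_all
  \<comment> \<open>Only the first inequality of (C) and of (D) can now fail.\<close>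
  then have "a2 + a6 \<ge> a3" "a4 + a6 \<ge> a5" "a3 + a6 \<ge> a2" "a5 + a6 \<ge> a4"
    by (simp_all add: trans_le_add2)
  \<comment> \<open>Once (C) and (D) fail, only the third inequality of (A) and of (B) can fail,
    which gives the bound on \<open>a6\<close>.\<close>
  moreover have "a1 + a2 \<ge> a4" "a1 + a3 \<ge> a5" "a1 + a4 \<ge> a2" "a1 + a5 \<ge> a3"
    if "a2 + a4 < a1" "a3 + a5 < a1"
    using that by linarith+
  ultimately show ?thesis
    unfolding assms(1) S_minimal_tetrahedral_curve_iff[OF assms(2)] max_less_iff_conj
    by (meson not_le)
qed

end
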